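(* Let $a,b,d\in\mathbb{Z}$ with $b\ge 1$ and $\gcd(a,b)=1$. Let $\ell$ be an odd prime divisor of $a+db$ and let $r$ be an integer with $0\le r<\ell$. Suppose that $d,\ell,r$ satisfy one of the following two conditions: \begin{enumerate} \item $d=2$, $\ell\equiv 3\pmod 4$ and $4r+1\equiv 0\pmod{\ell}$; \item $d=3$, $\ell\equiv 5$ or $7\pmod 8$ and $8r+3\equiv 0\pmod{\ell}$. \end{enumerate} Then for all integers $n\ge 0$, $$p_{[1,2;-a/b]}(\ell n+r)\equiv 0\pmod{\ell}.$$
   Context: For a rational number $t$ and an integer $m>1$, the rational numbers $p_{[1,m;t]}(n)$, $n\ge 0$, are defined by the formal power series identity $\sum_{n\ge 0}p_{[1,m;t]}(n)q^n=\prod_{j\ge 1}\big((1-q^j)(1-q^{mj})\big)^t$, where each power is the binomial series with constant term $1$. For a prime $\ell$ not dividing the denominator of $t$, a congruence $p_{[1,m;t]}(N)\equiv 0\pmod{\ell^k}$ means that the numerator of $p_{[1,m;t]}(N)$, written as a reduced fraction, is divisible by $\ell^k$ (the denominator is then coprime to $\ell$). *)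

theory Defs
  imports "HOL-Analysis.Analysis" "HOL-Number_Theory.Cong"
begin

text \<open>The power \<open>f\<^sup>t = (\<Sum>i. (t gchoose i) (f - 1)\<^sup>i)\<close>; meaningful only if \<open>f\<close> has
  constant term 1, as \<open>oo\<close> presupposes that its second argument has constant term 0.\<close>

definition fps_binomial_power :: "rat fps \<Rightarrow> rat \<Rightarrow> rat fps" where
  "fps_binomial_power f t = fps_binomial t oo (f - 1)"

text \<open>The infinite product is taken in the topology of formal power series (coefficientwise
  stabilisation); its factor with index \<open>j\<close> is the one belonging to \<open>Suc j\<close>. The constant
  \<^const>\<open>prodinf\<close> is a definite description; \<open>has_prod_p1\<close> below shows that
  the product converges, so that the description denotes its value.\<close>

definition p1_factor :: "nat \<Rightarrow> rat \<Rightarrow> nat \<Rightarrow> rat fps" where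
  "p1_factor m t j = fps_binomial_power ((1 - fps_X ^ j) * (1 - fps_X ^ (m * j))) t"

definition p1 :: "nat \<Rightarrow> rat \<Rightarrow> nat \<Rightarrow> rat" where
  "p1 m t n = fps_nth (prodinf (\<lambda>j. p1_factor m t (Suc j))) n"

lemma p1_factor_nth_0 [simp]: "fps_nth (p1_factor m t j) 0 = 1"
  by (simp add: p1_factor_def fps_binomial_power_def)

lemma p1_factor_nth_less:
  assumes "m > 0" "0 < i" "i < j"
  shows "fps_nth (p1_factor m t j) i = 0"
proof -
  define g :: "rat fps" where "g = (1 - fps_X ^ j) * (1 - fps_X ^ (m * j)) - 1"
  define h :: "rat fps" where "h = - 1 - fps_X ^ ((m - 1) * j) + fps_X ^ (m * j)"
  have mj: "m * j = j + (m - 1) * j"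
    using assms(1) by (cases m) auto
  have "g = fps_X ^ j * h"
    unfolding g_def h_def mj by (simp add: algebra_simps power_add)
  hence "g ^ k = fps_X ^ (j * k) * h ^ k" for k
    by (simp add: power_mult_distrib power_mult)
  moreover have "i < j * k" if "k > 0" for k
    using assms(3) that by (metis less_le_trans mult_le_mono2 nat_mult_1_right Suc_leI One_nat_def)
  ultimately have "fps_nth (g ^ k) i = 0" if "k > 0" for k
    using that by (simp add: fps_X_power_mult_nth)
  hence "(t gchoose k) * fps_nth (g ^ k) i = 0" for k
    using assms(2) by (cases "k = 0") auto
  hence "(\<Sum>k=0..i. (t gchoose k) * fps_nth (g ^ k) i) = 0"
    by (intro sum.neutral) blast
  thus ?thesis
    by (simp add: p1_factor_def fps_binomial_power_def fps_compose_nth flip: g_def)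
qed

lemma has_prod_p1:
  assumes "m > 0"
  shows "(\<lambda>j. p1_factor m t (Suc j)) has_prod Abs_fps (p1 m t)"
proof -
  let ?P = "\<lambda>n. \<Prod>j\<le>n. p1_factor m t (Suc j)"
  define L where "L = Abs_fps (\<lambda>k. fps_nth (?P k) k)"
  have step: "fps_nth (?P (Suc n)) k = fps_nth (?P n) k" if "k \<le> n" for n k
  proof -
    have "fps_nth (?P (Suc n)) k =
        (\<Sum>i=0..k. fps_nth (?P n) i * fps_nth (p1_factor m t (Suc (Suc n))) (k - i))"
      by (simp add: fps_mult_nth)
    also have "\<dots> = (\<Sum>i\<in>{k}. fps_nth (?P n) i * fps_nth (p1_factor m t (Suc (Suc n))) (k - i))"
      using that assms by (intro sum.mono_neutral_right) (auto simp: p1_factor_nth_less)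
    finally show ?thesis by simp
  qed
  have stable: "fps_nth (?P n) k = fps_nth L k" if "k \<le> n" for n k
    using that
  proof (induction n rule: dec_induct)
    case base
    show ?case by (simp add: L_def)
  next
    case (step n)
    thus ?case using \<open>\<And>n k. k \<le> n \<Longrightarrow> fps_nth (?P (Suc n)) k = fps_nth (?P n) k\<close> by metis
  qed
  have "?P \<longlonglongrightarrow> L"
    unfolding tendsto_fps_iff
    using stable by (auto intro: eventually_sequentiallyI)
  moreover have "fps_nth L 0 = 1"
    by (simp add: L_def)
  hence "L \<noteq> 0" by auto
  ultimately have "(\<lambda>j. p1_factor m t (Suc j)) has_prod L"
    by (simp add: has_prod_def raw_has_prod_def)
  moreover from this have "Abs_fps (p1 m t) = L"
    by (simp add: p1_def has_prod_unique[symmetric] fps_eq_iff)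
  ultimately show ?thesis by simp
qed

end

theory Submission
  imports Defs "HOL-Number_Theory.Gauss"
begin

text \<open>Put \<open>F = \<Prod>j. (1 - q\<^sup>j) (1 - q\<^bsup>2j\<^esup>)\<close> and write \<open>a + d b = l c\<close>, so that
  \<open>-a/b = d + l s\<close> with \<open>s = -c/b\<close>. Then \<open>F\<^bsup>-a/b\<^esup> = F\<^sup>d (F\<^sup>s)\<^sup>l\<close>. The coefficients of \<open>F\<^sup>s\<close> are
  \<open>l\<close>-integral, hence its \<open>l\<close>-th power is a series in \<open>q\<^sup>l\<close> modulo \<open>l\<close>, and it suffices that \<open>l\<close> divides
  the coefficient of \<open>q\<^sup>N\<close> in \<open>F\<^sup>d\<close> whenever \<open>N \<equiv> r\<close> modulo \<open>l\<close>. With \<open>E(q) = \<Prod>j. (1 - q\<^sup>j)\<close>,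
  the identities of Gauss and Jacobi, \<open>E(q)\<^sup>2 = E(q\<^sup>2) \<Sum>m. (-1)\<^sup>m q\<^bsup>m^2\<^esup>\<close> (over all integers \<open>m\<close>) and
  \<open>E(q)\<^sup>3 = \<Sum>n\<ge>0. (-1)\<^sup>n (2n+1) q\<^bsup>n(n+1)/2\<^esup>\<close>, turn \<open>F\<^sup>2 = E(q)\<^sup>2 E(q\<^sup>2)\<^sup>2\<close> into a double sum of terms
  \<open>\<plusminus> (2n+1) q\<^sup>N\<close> with \<open>4N+1 = (2m)\<^sup>2 + (2n+1)\<^sup>2\<close> and \<open>F\<^sup>3\<close> into a double sum of terms
  \<open>\<plusminus> (2m+1) (2n+1) q\<^sup>N\<close> with \<open>8N+3 = (2m+1)\<^sup>2 + 2 (2n+1)\<^sup>2\<close>. As \<open>-1\<close>, respectively \<open>-2\<close>, is not a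
  square modulo \<open>l\<close>, divisibility of the left-hand side by \<open>l\<close> forces \<open>l\<close> to divide \<open>2n+1\<close>.
  Only finitely many coefficients matter, so finite forms of both identities, consequences of the
  \<open>q\<close>-binomial theorem, are used, truncated at a fixed power of \<open>q\<close>.\<close>

subsection \<open>Binary quadratic forms modulo a prime\<close>

text \<open>Since \<open>p - 1\<close> is even, the sign of \<open>x\<close> drops out and Fermat's
  theorem for the absolute value suffices.\<close>

lemma fermat_int:
  fixes x :: int
  assumes "prime p" "\<not> int p dvd x" "odd p"
  shows "[x ^ (p - 1) = 1] (mod int p)"
proof -
  have "\<not> p dvd nat \<bar>x\<bar>"
    using assms(2) by (metis dvd_abs_iff int_dvd_int_iff int_nat_eq abs_ge_zero)
  hence "[nat \<bar>x\<bar> ^ (p - 1) = 1] (mod p)"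
    using assms(1) by (intro fermat_theorem)
  hence "[int (nat \<bar>x\<bar> ^ (p - 1)) = int 1] (mod int p)"
    by (simp only: cong_int_iff)
  moreover have "even (p - 1)" using assms(3) by simp
  ultimately show ?thesis by (simp add: power_even_abs)
qed

text \<open>The hypothesis on \<open>a\<close> is Euler's criterion for a non-residue. If
  \<open>p\<close> did not divide \<open>y\<close>, raising x^2 = a y^2 to the power (p - 1)/2 would
  make \<open>x ^ (p - 1)\<close> congruent to -1, whereas it is 0 or 1 modulo
  \<open>p\<close>.\<close>

lemma dvd_of_dvd_norm_form:
  fixes a x y :: int
  assumes p: "prime p" "odd p" and a: "[a ^ ((p - 1) div 2) = -1] (mod int p)"
    and xy: "int p dvd x\<^sup>2 - a * y\<^sup>2"
  shows "int p dvd x \<and> int p dvd y"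
proof -
  define h where "h = (p - 1) div 2"
  have h: "p - 1 = 2 * h" using p(2) by (auto simp: h_def)
  have p3: "p \<ge> 3" using p prime_ge_2_nat[of p] by (cases "p = 2") auto
  have c: "[x\<^sup>2 = a * y\<^sup>2] (mod int p)" using xy by (simp add: cong_iff_dvd_diff)
  have y: "int p dvd y"
  proof (rule ccontr)
    assume ny: "\<not> int p dvd y"
    have "[x ^ (p - 1) = (x\<^sup>2) ^ h] (mod int p)" by (simp only: h power_mult cong_refl)
    also have "[(x\<^sup>2) ^ h = (a * y\<^sup>2) ^ h] (mod int p)" using c by (rule cong_pow)
    also have "(a * y\<^sup>2) ^ h = a ^ h * y ^ (p - 1)"
      by (simp only: power_mult_distrib h power_mult)
    also have "[\<dots> = (-1) * 1] (mod int p)"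
      using a fermat_int[OF p(1) ny p(2)] unfolding h_def by (rule cong_mult)
    finally have *: "[x ^ (p - 1) = -1] (mod int p)" by simp
    show False
    proof (cases "int p dvd x")
      case True
      hence "int p dvd x ^ (p - 1)" using p3 by (intro dvd_trans[OF _ dvd_power]) auto
      hence "int p dvd -1" using * by (simp add: cong_dvd_iff)
      thus False using p3 by simp
    next
      case False
      from cong_trans[OF cong_sym[OF *] fermat_int[OF p(1) False p(2)]]
      have "int p dvd (-1) - 1" by (simp only: cong_iff_dvd_diff)
      hence "int p dvd 2" by simp
      thus False using p3 zdvd_imp_le by fastforce
    qed
  qed
  hence "int p dvd a * y\<^sup>2" by (simp add: power2_eq_square)
  hence "int p dvd x\<^sup>2" using xy by (metis diff_add_cancel dvd_add)
  hence "int p dvd x" using p(1) by (simp add: prime_dvd_power_iff)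
  with y show ?thesis by blast
qed

lemma minus_one_power_half:
  assumes "[p = 3] (mod 4)"
  shows "[(-1) ^ ((p - 1) div 2) = -1] (mod int p)"
proof -
  have "odd ((p - 1) div 2)" using assms unfolding cong_def by presburger
  thus ?thesis by simp
qed

text \<open>Gauss's lemma for the multiplier 2, combined with the sign of -1. In both residue
  classes \<open>h div 2\<close> is odd, where h = (p - 1)/2.\<close>

lemma minus_two_power_half:
  assumes p: "prime p" and m: "[p = 5] (mod 8) \<or> [p = 7] (mod 8)"
  shows "[(-2) ^ ((p - 1) div 2) = -1] (mod int p)"
proof -
  define h where "h = (p - 1) div 2"
  define k where "k = p div 8"
  have "p mod 8 = 5 \<or> p mod 8 = 7" using m by (auto simp: cong_def)
  hence "p = 8 * k + 5 \<or> p = 8 * k + 7" unfolding k_def by (metis mult_div_mod_eq)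
  hence "p = 2 * h + 1 \<and> p \<ge> 5 \<and> h div 2 = 2 * k + 1" by (auto simp: h_def)
  hence ph: "p = 2 * h + 1" and p5: "p \<ge> 5" and hodd: "odd (h div 2)" by auto
  interpret G: GAUSS p 2
    using p p5 by unfold_locales (auto simp: cong_0_iff dest: zdvd_imp_le)
  have hh: "(int p - 1) div 2 = int h" by (simp add: ph)
  \<comment> \<open>Twice a number up to \<open>h\<close> is less than \<open>p\<close>, so nothing
    is reduced modulo \<open>p\<close>, and the doubles exceeding \<open>h\<close> come exactly from
    the numbers above \<open>h div 2\<close>.\<close>
  have "G.E = (\<lambda>x. x * 2) ` {int (h div 2) <.. int h}"
    unfolding G.E_def G.C_def G.B_def G.A_def hh
  proof (intro equalityI subsetI)
    fix z assume "z \<in> (\<lambda>x. x mod int p) ` (\<lambda>x. x * 2) ` {0<..int h} \<inter> {int h<..}"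
    then obtain x where x: "0 < x" "x \<le> int h" "z = (x * 2) mod int p" "z > int h" by auto
    moreover from x have "(x * 2) mod int p = x * 2" by (intro mod_pos_pos_trivial) (auto simp: ph)
    ultimately show "z \<in> (\<lambda>x. x * 2) ` {int (h div 2) <.. int h}"
      by (intro image_eqI[of _ _ x]) auto
  next
    fix z assume "z \<in> (\<lambda>x. x * 2) ` {int (h div 2) <.. int h}"
    then obtain x where x: "int (h div 2) < x" "x \<le> int h" "z = x * 2" by auto
    moreover from x have "(x * 2) mod int p = x * 2" by (intro mod_pos_pos_trivial) (auto simp: ph)
    moreover have "int h < x * 2" using x(1) by linarith
    moreover have "0 < x" using x(1) by linarith
    ultimately show "z \<in> (\<lambda>x. x mod int p) ` (\<lambda>x. x * 2) ` {0<..int h} \<inter> {int h<..}"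
      by (auto simp: image_image intro!: image_eqI[of _ _ x])
  qed
  hence "card G.E = h - h div 2"
    by (simp add: card_image inj_on_def nat_diff_distrib')
  hence "[2 ^ h = (-1) ^ (h - h div 2)] (mod int p)"
    using G.pre_gauss_lemma by (simp add: hh)
  hence "[(-1) ^ h * 2 ^ h = (-1) ^ h * (-1) ^ (h - h div 2)] (mod int p)"
    by (rule cong_scalar_left)
  moreover have "(-1 :: int) ^ h * 2 ^ h = (-2) ^ h"
    by (simp flip: power_mult_distrib)
  \<comment> \<open>The two sign exponents add up to a number of the same parity as
    \<open>h div 2\<close>.\<close>
  moreover have "odd (h + (h - h div 2))" using hodd by presburger
  ultimately show ?thesis by (simp add: h_def flip: power_add)
qed

subsection \<open>Finite forms of the identities of Gauss and Jacobi\<close>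

text \<open>The q-Pochhammer symbol (q; q)_n. With base \<open>fps_X ^ c\<close> it is a partial
  product of E at the c-th power of the variable.\<close>

definition qpoch :: "'a :: comm_ring_1 \<Rightarrow> nat \<Rightarrow> 'a" where
  "qpoch q n = (\<Prod>i<n. 1 - q ^ Suc i)"

lemma qpoch_0 [simp]: "qpoch q 0 = 1"
  by (simp add: qpoch_def)

lemma qpoch_Suc: "qpoch q (Suc n) = qpoch q n * (1 - q ^ Suc n)"
  by (simp add: qpoch_def)

text \<open>The Gaussian binomial coefficients. A Pascal-type recurrence defines them in any
  commutative ring, where quotients of \<open>qpoch\<close> need not make sense.\<close>

fun qbin :: "'a :: comm_ring_1 \<Rightarrow> nat \<Rightarrow> nat \<Rightarrow> 'a" where
  "qbin q n 0 = 1"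
| "qbin q 0 (Suc k) = 0"
| "qbin q (Suc n) (Suc k) = qbin q n (Suc k) + q ^ (n - k) * qbin q n k"

lemma qbin_eq_0: "n < k \<Longrightarrow> qbin q n k = 0"
  by (induction q n k rule: qbin.induct) auto

lemma qbin_self [simp]: "qbin q n n = 1"
  by (induction n) (auto simp: qbin_eq_0)

text \<open>Allows the q-binomial theorem to be applied in a polynomial ring with a constant
  base.\<close>

lemma qbin_const_poly: "qbin [:q:] n k = [:qbin q n k:]"
  by (induction q n k rule: qbin.induct) (auto simp: poly_const_pow one_pCons)

text \<open>The quotient formula for Gaussian binomial coefficients, cleared of
  denominators.\<close>

lemma qbin_mult_qpoch:
  assumes "k \<le> n"
  shows "qbin q n k * qpoch q k * qpoch q (n - k) = qpoch q n"
  using assms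
proof (induction n arbitrary: k)
  case (Suc n)
  show ?case
  proof (cases k)
    case (Suc l)
    show ?thesis
    proof (cases "l = n")
      case False
      with Suc Suc.prems have l: "Suc l \<le> n" by simp
      define A where "A = qbin q n (Suc l)"
      define B where "B = qbin q n l"
      have IH1: "A * qpoch q (Suc l) * qpoch q (n - Suc l) = qpoch q n"
        unfolding A_def using l by (rule Suc.IH)
      have IH2: "B * qpoch q l * qpoch q (n - l) = qpoch q n"
        unfolding B_def using l by (intro Suc.IH) simp
      have nl: "qpoch q (n - l) = qpoch q (n - Suc l) * (1 - q ^ (n - l))"
        using l qpoch_Suc[of q "n - Suc l"] by (simp add: Suc_diff_Suc)
      have "qbin q (Suc n) k * qpoch q k * qpoch q (Suc n - k)
          = (A + q ^ (n - l) * B) * qpoch q (Suc l) * qpoch q (n - l)"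
        by (simp add: Suc A_def B_def)
      \<comment> \<open>Each summand contains the left-hand side of one induction hypothesis; the
        remaining factors add up to \<open>1 - q ^ Suc n\<close>.\<close>
      also have "\<dots> = (A * qpoch q (Suc l) * qpoch q (n - Suc l)) * (1 - q ^ (n - l))
           + (B * qpoch q l * qpoch q (n - l)) * (q ^ (n - l) * (1 - q ^ Suc l))"
        unfolding distrib_right by (subst (1) nl, subst (2) qpoch_Suc) (simp only: mult_ac)
      also have "\<dots> = qpoch q n * (1 - q ^ (n - l) * q ^ Suc l)"
        unfolding IH1 IH2 by (simp add: algebra_simps)
      also have "q ^ (n - l) * q ^ Suc l = q ^ Suc n"
        using l by (simp flip: power_add power_Suc)
      finally show ?thesis by (simp add: qpoch_Suc)
    qed (simp add: Suc qbin_eq_0)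
  qed auto
qed auto

text \<open>The form homogeneous in \<open>x\<close> and \<open>y\<close> admits a power of
  \<open>q\<close>, or a multiple of a polynomial variable, for \<open>y\<close> without any
  division.\<close>

theorem q_binomial:
  fixes x y q :: "'a :: comm_ring_1"
  shows "(\<Prod>i<n. y + x * q ^ i) = (\<Sum>k\<le>n. q ^ (k choose 2) * qbin q n k * x ^ k * y ^ (n - k))"
proof (induction n)
  case (Suc n)
  \<comment> \<open>\<open>T k\<close> and \<open>U k\<close> arise from multiplying the k-th
    summand by \<open>y\<close> and by \<open>x * q ^ n\<close>. The recurrence of
    \<open>qbin\<close> merges \<open>T (Suc k)\<close> with \<open>U k\<close>.\<close>
  define T where "T = (\<lambda>k. q ^ (k choose 2) * qbin q n k * x ^ k * y ^ (Suc n - k))"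
  define U where "U = (\<lambda>k. q ^ (Suc k choose 2) * (q ^ (n - k) * qbin q n k) * x ^ Suc k * y ^ (n - k))"
  have "(\<Prod>i<Suc n. y + x * q ^ i)
      = (\<Sum>k\<le>n. q ^ (k choose 2) * qbin q n k * x ^ k * y ^ (n - k)) * (y + x * q ^ n)"
    by (simp add: Suc.IH)
  also have "\<dots> = (\<Sum>k\<le>n. T k + U k)"
    unfolding sum_distrib_right
  proof (intro sum.cong refl)
    fix k assume "k \<in> {..n}"
    hence k: "k \<le> n" by simp
    have "q ^ n = q ^ k * q ^ (n - k)" using k by (simp flip: power_add)
    moreover have "q ^ (Suc k choose 2) = q ^ (k choose 2) * q ^ k"
      by (simp add: numeral_2_eq_2 power_add mult_ac)
    ultimately show "q ^ (k choose 2) * qbin q n k * x ^ k * y ^ (n - k) * (y + x * q ^ n) = T k + U k"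
      using k by (simp add: T_def U_def Suc_diff_le algebra_simps)
  qed
  also have "\<dots> = (\<Sum>k\<le>Suc n. T k) + (\<Sum>k\<le>n. U k)"
    by (simp add: sum.distrib T_def qbin_eq_0)
  also have "\<dots> = T 0 + (\<Sum>k\<le>n. T (Suc k) + U k)"
    by (simp only: sum.atMost_Suc_shift sum.distrib add.assoc)
  also have "(\<Sum>k\<le>n. T (Suc k) + U k)
      = (\<Sum>k\<le>n. q ^ (Suc k choose 2) * qbin q (Suc n) (Suc k) * x ^ Suc k * y ^ (Suc n - Suc k))"
    by (intro sum.cong refl) (simp add: T_def U_def algebra_simps)
  also have "T 0 = q ^ (0 choose 2) * qbin q (Suc n) 0 * x ^ 0 * y ^ (Suc n - 0)"
    by (simp add: T_def)
  finally show ?case by (simp only: sum.atMost_Suc_shift)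
qed (simp add: numeral_2_eq_2)

lemma two_mult_choose_two: "2 * int (k choose 2) = int k * (int k - 1)"
  by (induction k) (auto simp: numeral_2_eq_2 algebra_simps)

lemma prod_power_lessThan: "(\<Prod>i<n. q ^ i) = (q :: 'a :: comm_ring_1) ^ (n choose 2)"
  by (induction n) (auto simp: numeral_2_eq_2 power_add mult_ac)

lemma prod_lessThan_add:
  fixes f :: "nat \<Rightarrow> 'a :: comm_monoid_mult"
  shows "(\<Prod>i<m + n. f i) = (\<Prod>i<m. f i) * (\<Prod>j<n. f (m + j))"
  by (induction n) (auto simp: mult.assoc)

text \<open>The product of q^(2n) - q^(2i+1) over i < 2n is evaluated twice: by extracting the lower
  power of \<open>q\<close> from each factor, and by the q-binomial theorem with base
  \<open>q\<^sup>2\<close>. Both sides carry \<open>q ^ (3 * n\<^sup>2)\<close>, which is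
  cancelled.\<close>

lemma finite_gauss:
  fixes q :: "'a :: idom"
  assumes "q \<noteq> 0"
  shows "(\<Prod>i<n. 1 - q ^ (2 * i + 1)) ^ 2 =
    (\<Sum>k\<le>2*n. (-1) ^ (n + k) * q ^ nat ((int k - int n)\<^sup>2) * qbin (q\<^sup>2) (2 * n) k)"
proof -
  define P where "P = (\<Prod>i<n. 1 - q ^ (2 * i + 1))"
  define f where "f = (\<lambda>i. q ^ (2 * n) + (-q) * (q\<^sup>2) ^ i)"
  have "(\<Prod>i<n. f i) = (\<Prod>i<n. (-q) * (q\<^sup>2) ^ i * (1 - q ^ (2 * (n - Suc i) + 1)))"
  proof (intro prod.cong refl)
    fix i assume "i \<in> {..<n}"
    hence "2 * n = Suc (2 * i + (2 * (n - Suc i) + 1))" by simp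
    hence "q ^ (2 * n) = q * (q\<^sup>2) ^ i * q ^ (2 * (n - Suc i) + 1)"
      by (metis power_Suc power_add power_mult mult.assoc)
    thus "f i = (-q) * (q\<^sup>2) ^ i * (1 - q ^ (2 * (n - Suc i) + 1))"
      by (simp only: f_def) (simp add: algebra_simps)
  qed
  also have "\<dots> = (-q) ^ n * (q\<^sup>2) ^ (n choose 2) * (\<Prod>i<n. 1 - q ^ (2 * (n - Suc i) + 1))"
    by (simp only: prod.distrib prod_power_lessThan) simp
  also have "(\<Prod>i<n. 1 - q ^ (2 * (n - Suc i) + 1)) = P"
    unfolding P_def by (rule prod.nat_diff_reindex)
  finally have 1: "(\<Prod>i<n. f i) = (-q) ^ n * (q\<^sup>2) ^ (n choose 2) * P" .
  have "(\<Prod>j<n. f (n + j)) = (\<Prod>j<n. q ^ (2 * n) * (1 - q ^ (2 * j + 1)))"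
    by (intro prod.cong refl) (simp add: f_def algebra_simps power_add power_mult power2_eq_square)
  also have "\<dots> = q ^ (2 * n * n) * P"
    by (simp add: P_def prod.distrib power_mult)
  finally have 2: "(\<Prod>j<n. f (n + j)) = q ^ (2 * n * n) * P" .
  have e: "n + 2 * (n choose 2) + 2 * n * n = 3 * n\<^sup>2"
  proof -
    have "int (n + 2 * (n choose 2) + 2 * n * n) = int (3 * n\<^sup>2)"
      using two_mult_choose_two[of n] by (simp add: power2_eq_square algebra_simps)
    thus ?thesis by (simp only: of_nat_eq_iff)
  qed
  have "(\<Prod>i<2*n. f i) = (\<Prod>i<n. f i) * (\<Prod>j<n. f (n + j))"
    by (simp only: mult_2 prod_lessThan_add)
  also have "\<dots> = (-1) ^ n * q ^ (n + 2 * (n choose 2) + 2 * n * n) * P\<^sup>2"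
    unfolding 1 2 by (simp add: power_minus[of q] power_add power_mult power2_eq_square mult_ac)
  also have "\<dots> = (-1) ^ n * q ^ (3 * n\<^sup>2) * P\<^sup>2"
    by (simp only: e)
  finally have L: "(\<Prod>i<2*n. f i) = (-1) ^ n * q ^ (3 * n\<^sup>2) * P\<^sup>2" .
  have "(\<Prod>i<2*n. f i) = (\<Sum>k\<le>2*n. (q\<^sup>2) ^ (k choose 2) * qbin (q\<^sup>2) (2*n) k * (-q) ^ k * (q ^ (2*n)) ^ (2*n - k))"
    unfolding f_def by (rule q_binomial)
  also have "\<dots> = (\<Sum>k\<le>2*n. q ^ (3 * n\<^sup>2) * ((-1) ^ k * q ^ nat ((int k - int n)\<^sup>2) * qbin (q\<^sup>2) (2 * n) k))"
  proof (intro sum.cong refl)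
    fix k assume "k \<in> {..2*n}"
    hence k: "k \<le> 2 * n" by simp
    have m: "int (2 * n - k) = 2 * int n - int k" using k by simp
    have "int (2 * (k choose 2) + k + 2 * n * (2 * n - k)) = int k * (int k - 1) + int k + 2 * int n * (2 * int n - int k)"
      by (simp only: of_nat_add of_nat_mult m two_mult_choose_two of_nat_numeral)
    also have "\<dots> = 3 * (int n)\<^sup>2 + (int k - int n)\<^sup>2"
      by (simp add: power2_eq_square algebra_simps)
    also have "\<dots> = int (3 * n\<^sup>2 + nat ((int k - int n)\<^sup>2))"
      by simp
    finally have "int (2 * (k choose 2) + k + 2 * n * (2 * n - k)) = int (3 * n\<^sup>2 + nat ((int k - int n)\<^sup>2))" .
    hence e: "2 * (k choose 2) + k + 2 * n * (2 * n - k) = 3 * n\<^sup>2 + nat ((int k - int n)\<^sup>2)"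
      by (simp only: of_nat_eq_iff)
    have "(q\<^sup>2) ^ (k choose 2) * qbin (q\<^sup>2) (2*n) k * (-q) ^ k * (q ^ (2*n)) ^ (2*n - k)
        = (-1) ^ k * q ^ (2 * (k choose 2) + k + 2 * n * (2 * n - k)) * qbin (q\<^sup>2) (2*n) k"
      by (simp only: power_minus[of q] power_add power_mult mult_ac)
    thus "(q\<^sup>2) ^ (k choose 2) * qbin (q\<^sup>2) (2*n) k * (-q) ^ k * (q ^ (2*n)) ^ (2*n - k)
        = q ^ (3 * n\<^sup>2) * ((-1) ^ k * q ^ nat ((int k - int n)\<^sup>2) * qbin (q\<^sup>2) (2 * n) k)"
      unfolding e by (simp only: power_add mult_ac)
  qed
  finally have "q ^ (3 * n\<^sup>2) * ((-1) ^ n * P\<^sup>2) =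
      q ^ (3 * n\<^sup>2) * (\<Sum>k\<le>2*n. (-1) ^ k * q ^ nat ((int k - int n)\<^sup>2) * qbin (q\<^sup>2) (2 * n) k)"
    unfolding L by (simp only: sum_distrib_left mult_ac)
  hence "(-1) ^ n * P\<^sup>2 = (\<Sum>k\<le>2*n. (-1) ^ k * q ^ nat ((int k - int n)\<^sup>2) * qbin (q\<^sup>2) (2 * n) k)"
    using assms by simp
  \<comment> \<open>The sign is its own inverse, so a second multiplication moves it to the other
    side.\<close>
  hence "(-1) ^ n * ((-1) ^ n * P\<^sup>2) = (-1) ^ n * (\<Sum>k\<le>2*n. (-1) ^ k * q ^ nat ((int k - int n)\<^sup>2) * qbin (q\<^sup>2) (2 * n) k)"
    by simp
  thus ?thesis
    by (simp add: P_def sum_distrib_left power_add mult.assoc[symmetric] flip: power_mult_distrib)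
qed

text \<open>The \<open>q\<close>-binomial theorem exhibits \<open>\<Prod>i\<le>2n. (q\<^sup>n t - q\<^sup>i)\<close> as a polynomial in \<open>t\<close>;
  since it vanishes at \<open>t = 1\<close>, only the factor \<open>i = n\<close> contributes to its derivative there.\<close>

lemma finite_jacobi:
  fixes q :: "'a :: idom"
  assumes "q \<noteq> 0"
  shows "2 * qpoch q n ^ 2 =
    (\<Sum>k\<le>2*n+1. (-1) ^ (n + k) * of_int (2 * int n + 1 - 2 * int k) *
       q ^ nat ((int k - int n) * (int k - int n - 1) div 2) * qbin q (2 * n + 1) k)"
proof -
  define N where "N = 2 * n + 1"
  define c where "c = (\<lambda>k. (-1) ^ k * q ^ ((k choose 2) + n * (N - k)) * qbin q N k)"
  define P where "P = (\<Prod>i<N. [:- (q ^ i), q ^ n:])"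
  have "P = (\<Prod>i<N. [:0, q ^ n:] + [:-1:] * [:q:] ^ i)"
    unfolding P_def by (intro prod.cong refl) (simp add: poly_const_pow)
  also have "\<dots> = (\<Sum>k\<le>N. [:q:] ^ (k choose 2) * qbin [:q:] N k * [:-1:] ^ k * [:0, q ^ n:] ^ (N - k))"
    by (rule q_binomial)
  also have "\<dots> = (\<Sum>k\<le>N. Polynomial.monom (c k) (N - k))"
  proof (intro sum.cong refl)
    fix k
    have "[:0, q ^ n:] ^ (N - k) = Polynomial.monom (q ^ (n * (N - k))) (N - k)"
      by (simp add: monom_altdef power_mult flip: smult_power)
    thus "[:q:] ^ (k choose 2) * qbin [:q:] N k * [:-1:] ^ k * [:0, q ^ n:] ^ (N - k) = Polynomial.monom (c k) (N - k)"
      by (simp add: qbin_const_poly poly_const_pow c_def smult_monom power_add mult_ac)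
  qed
  finally have P: "P = (\<Sum>k\<le>N. Polynomial.monom (c k) (N - k))" .
  have split: "{..<N} - {n} = {..<n} \<union> (\<lambda>j. n + Suc j) ` {..<n}"
  proof (intro equalityI subsetI)
    fix i assume i: "i \<in> {..<N} - {n}"
    show "i \<in> {..<n} \<union> (\<lambda>j. n + Suc j) ` {..<n}"
    proof (cases "i < n")
      case False
      with i show ?thesis by (intro UnI2 image_eqI[of _ _ "i - Suc n"]) (auto simp: N_def)
    qed auto
  qed (auto simp: N_def)
  define R where "R = (\<Prod>i\<in>{..<N} - {n}. [:- (q ^ i), q ^ n:])"
  have PR: "P = [:- (q ^ n), q ^ n:] * R"
    unfolding P_def R_def by (intro prod.remove) (auto simp: N_def)
  have "poly R 1 = (\<Prod>i\<in>{..<N} - {n}. q ^ n - q ^ i)"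
    by (simp add: R_def poly_prod)
  also have "\<dots> = (\<Prod>i<n. q ^ n - q ^ i) * (\<Prod>j<n. q ^ n - q ^ (n + Suc j))"
    unfolding split by (subst prod.union_disjoint) (auto simp: prod.reindex inj_on_def)
  also have "(\<Prod>i<n. q ^ n - q ^ i) = (\<Prod>i<n. (-1) * q ^ i * (1 - q ^ Suc (n - Suc i)))"
  proof (intro prod.cong refl)
    fix i assume "i \<in> {..<n}"
    hence "q ^ n = q ^ i * q ^ Suc (n - Suc i)" by (simp only: power_add[symmetric]) simp
    thus "q ^ n - q ^ i = (-1) * q ^ i * (1 - q ^ Suc (n - Suc i))"
      by (simp only:) (simp add: algebra_simps)
  qed
  also have "\<dots> = (-1) ^ n * q ^ (n choose 2) * (\<Prod>i<n. 1 - q ^ Suc (n - Suc i))"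
    by (simp only: prod.distrib prod_power_lessThan) simp
  also have "(\<Prod>i<n. 1 - q ^ Suc (n - Suc i)) = qpoch q n"
    unfolding qpoch_def by (rule prod.nat_diff_reindex)
  also have "(\<Prod>j<n. q ^ n - q ^ (n + Suc j)) = (\<Prod>j<n. q ^ n * (1 - q ^ Suc j))"
    by (simp add: power_add algebra_simps)
  also have "\<dots> = q ^ (n * n) * qpoch q n"
    by (simp only: prod.distrib qpoch_def) (simp add: power_mult)
  finally have R1: "poly R 1 = (-1) ^ n * q ^ ((n choose 2) + n * n) * qpoch q n ^ 2"
    by (simp add: power_add power2_eq_square mult_ac)
  have "(\<Sum>k\<le>N. c k) = 0"
    using arg_cong[OF P, of "\<lambda>p. poly p 1"] by (simp add: PR poly_sum poly_monom)
  moreover have "(\<Sum>k\<le>N. of_nat (N - k) * c k) = q ^ n * poly R 1"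
  proof -
    have "poly (pderiv P) 1 = q ^ n * poly R 1"
      unfolding PR by (simp only: pderiv_mult poly_add poly_mult) (simp add: pderiv_pCons)
    moreover have "poly (pderiv P) 1 = (\<Sum>k\<le>N. of_nat (N - k) * c k)"
      unfolding P by (simp add: higher_pderiv_sum[of 1, simplified] pderiv_monom poly_sum poly_monom del: of_nat_diff)
    ultimately show ?thesis by simp
  qed
  \<comment> \<open>Subtracting N times the vanishing sum of the \<open>c k\<close> from twice the
    derivative turns the weight N - k into N - 2k, antisymmetric under k -> N - k. Terms paired by
    this reflection are then equal, which accounts for the factor 2.\<close>
  ultimately have "2 * (q ^ n * poly R 1) = (\<Sum>k\<le>N. 2 * (of_nat (N - k) * c k)) - (\<Sum>k\<le>N. of_nat N * c k)"
    by (simp flip: sum_distrib_left)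
  also have "\<dots> = (\<Sum>k\<le>N. of_int (int N - 2 * int k) * c k)"
    unfolding sum_subtractf[symmetric]
    by (intro sum.cong refl) (simp add: of_nat_diff algebra_simps)
  also have "\<dots> = (\<Sum>k\<le>N. q ^ (n + (n choose 2) + n * n) * ((-1) ^ k * of_int (int N - 2 * int k) *
       q ^ nat ((int k - int n) * (int k - int n - 1) div 2) * qbin q N k))"
  proof (intro sum.cong refl)
    fix k assume "k \<in> {..N}"
    hence k: "k \<le> N" by simp
    define j where "j = int k - int n"
    \<comment> \<open>A product of consecutive integers is nonnegative and even, so
      \<open>nat\<close> and \<open>div\<close> lose nothing.\<close>
    have "j * (j - 1) \<ge> 0" by (cases "j \<le> 0") (auto intro: mult_nonpos_nonpos)
    moreover have "even (j * (j - 1))" by simp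
    ultimately have j: "2 * int (nat (j * (j - 1) div 2)) = j * (j - 1)" by auto
    have m: "int (N - k) = 2 * int n + 1 - int k" using k by (simp add: N_def)
    have "2 * int ((k choose 2) + n * (N - k)) = int k * (int k - 1) + 2 * int n * (2 * int n + 1 - int k)"
      by (simp only: of_nat_add of_nat_mult m two_mult_choose_two distrib_left mult.assoc)
    also have "\<dots> = 2 * int n + int n * (int n - 1) + 2 * (int n * int n) + j * (j - 1)"
      by (simp add: j_def algebra_simps)
    also have "\<dots> = 2 * int (n + (n choose 2) + n * n + nat (j * (j - 1) div 2))"
      by (simp only: of_nat_add of_nat_mult two_mult_choose_two distrib_left j)
    finally have "2 * int ((k choose 2) + n * (N - k)) = 2 * int (n + (n choose 2) + n * n + nat (j * (j - 1) div 2))" .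
    hence "(k choose 2) + n * (N - k) = n + (n choose 2) + n * n + nat (j * (j - 1) div 2)"
      by (simp only: mult_cancel_left of_nat_eq_iff) simp
    thus "of_int (int N - 2 * int k) * c k = q ^ (n + (n choose 2) + n * n) * ((-1) ^ k * of_int (int N - 2 * int k) *
       q ^ nat ((int k - int n) * (int k - int n - 1) div 2) * qbin q N k)"
      unfolding c_def j_def by (simp only: power_add mult_ac)
  qed
  finally have "q ^ (n + (n choose 2) + n * n) * ((-1) ^ n * (2 * qpoch q n ^ 2)) =
     q ^ (n + (n choose 2) + n * n) * (\<Sum>k\<le>N. (-1) ^ k * of_int (int N - 2 * int k) *
       q ^ nat ((int k - int n) * (int k - int n - 1) div 2) * qbin q N k)"
    unfolding R1 sum_distrib_left[symmetric] by (simp only: power_add mult_ac)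
  hence "(-1) ^ n * (2 * qpoch q n ^ 2) = (\<Sum>k\<le>N. (-1) ^ k * of_int (int N - 2 * int k) *
       q ^ nat ((int k - int n) * (int k - int n - 1) div 2) * qbin q N k)"
    using assms by (subst (asm) mult_cancel_left) simp
  hence "(-1) ^ n * ((-1) ^ n * (2 * qpoch q n ^ 2)) = (-1) ^ n * (\<Sum>k\<le>N. (-1) ^ k * of_int (int N - 2 * int k) *
       q ^ nat ((int k - int n) * (int k - int n - 1) div 2) * qbin q N k)"
    by (rule arg_cong)
  moreover have "(-1 :: 'a) ^ n * ((-1) ^ n * x) = x" for x
    by (simp add: mult.assoc[symmetric] flip: power_mult_distrib)
  moreover have "int N = 2 * int n + 1" by (simp add: N_def)
  ultimately show ?thesis
    by (simp only: N_def[symmetric] sum_distrib_left power_add mult.assoc)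
qed

subsection \<open>Truncated identities\<close>

text \<open>Congruence modulo \<open>fps_X ^ M\<close>.\<close>

definition fps_agree :: "nat \<Rightarrow> 'a :: zero fps \<Rightarrow> 'a fps \<Rightarrow> bool" where
  "fps_agree M f g \<longleftrightarrow> (\<forall>n<M. fps_nth f n = fps_nth g n)"

lemma fps_agree_refl [simp]: "fps_agree M f f"
  by (simp add: fps_agree_def)

lemma fps_agree_sym: "fps_agree M f g \<Longrightarrow> fps_agree M g f"
  by (simp add: fps_agree_def)

lemma fps_agree_trans [trans]: "fps_agree M f g \<Longrightarrow> fps_agree M g h \<Longrightarrow> fps_agree M f h"
  by (simp add: fps_agree_def)

lemma fps_agree_diff: "fps_agree M f g \<Longrightarrow> fps_agree M f' g' \<Longrightarrow> fps_agree M (f - f') (g - g')"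
  for f g :: "'a :: group_add fps"
  by (simp add: fps_agree_def)

lemma fps_agree_mult: "fps_agree M f g \<Longrightarrow> fps_agree M f' g' \<Longrightarrow> fps_agree M (f * f') (g * g')"
  for f g :: "'a :: semiring_0 fps"
  by (auto simp: fps_agree_def fps_mult_nth intro!: sum.cong)

lemma fps_agree_power: "fps_agree M f g \<Longrightarrow> fps_agree M (f ^ k) (g ^ k)"
  for f g :: "'a :: semiring_1 fps"
  by (induction k) (auto intro: fps_agree_mult)

lemma fps_agree_sum: "(\<And>i. i \<in> A \<Longrightarrow> fps_agree M (f i) (g i)) \<Longrightarrow> fps_agree M (sum f A) (sum g A)"
  for f g :: "'b \<Rightarrow> 'a :: comm_monoid_add fps"
  by (auto simp: fps_agree_def fps_sum_nth intro!: sum.cong)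

lemma fps_agree_cancel:
  fixes f g h :: "'a :: field fps"
  assumes "fps_agree M (f * h) (g * h)" "fps_nth h 0 \<noteq> 0"
  shows "fps_agree M f g"
proof -
  have "fps_agree M (f * h * inverse h) (g * h * inverse h)"
    using assms(1) by (rule fps_agree_mult) simp
  thus ?thesis using assms(2) by (simp add: mult.assoc inverse_mult_eq_1')
qed

lemma fps_agree_X_power_mult_0:
  fixes f :: "'a :: comm_ring_1 fps"
  assumes "c > 0" "M \<le> e"
  shows "fps_agree M ((fps_X ^ c) ^ e * f) 0"
proof -
  have "e \<le> c * e" using assms(1) by (cases c) auto
  with assms(2) have "M \<le> c * e" by (rule le_trans)
  thus ?thesis
    by (auto simp: fps_agree_def fps_X_power_mult_nth simp flip: power_mult)
qed

lemma qpoch_nth_0: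
  assumes "c > 0"
  shows "fps_nth (qpoch (fps_X ^ c) n) 0 = (1 :: 'a :: field)"
  using assms by (induction n) (auto simp: qpoch_Suc)

text \<open>Every factor beyond the first \<open>M\<close> is 1 modulo
  \<open>fps_X ^ M\<close>.\<close>

lemma fps_agree_qpoch:
  assumes "c > 0" "M \<le> n"
  shows "fps_agree M (qpoch (fps_X ^ c) n) (qpoch (fps_X ^ c) M :: 'a :: field fps)"
  using assms(2)
proof (induction n rule: dec_induct)
  case (step n)
  have "fps_agree M (qpoch (fps_X ^ c) n - (fps_X ^ c) ^ Suc n * qpoch (fps_X ^ c) n)
      (qpoch (fps_X ^ c) M - 0 :: 'a fps)"
    using step assms(1) by (intro fps_agree_diff fps_agree_X_power_mult_0) auto
  thus ?case by (simp add: qpoch_Suc algebra_simps)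
qed auto

text \<open>Far from both ends of its row a Gaussian coefficient approximates the inverse of E: in
  the quotient formula all three products agree with \<open>qpoch (fps_X ^ c) M\<close>, and one of
  them cancels.\<close>

lemma fps_agree_qbin:
  assumes c: "c > 0" and k: "M \<le> k" "M + k \<le> n"
  shows "fps_agree M (qbin (fps_X ^ c) n k * qpoch (fps_X ^ c) M) (1 :: 'a :: field fps)"
proof (rule fps_agree_cancel)
  define E :: "nat \<Rightarrow> 'a fps" where "E = qpoch (fps_X ^ c)"
  have "fps_agree M (qbin (fps_X ^ c) n k * E M * E M) (qbin (fps_X ^ c) n k * E k * E (n - k))"
    unfolding E_def using c k
    by (intro fps_agree_mult fps_agree_refl fps_agree_sym[OF fps_agree_qpoch]) auto
  also have "qbin (fps_X ^ c) n k * E k * E (n - k) = E n"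
    unfolding E_def using k by (intro qbin_mult_qpoch) simp
  also have "fps_agree M (E n) (1 * E M)"
    unfolding E_def using c k by (simp add: fps_agree_qpoch)
  finally show "fps_agree M (qbin (fps_X ^ c) n k * E M * E M) (1 * E M)" .
qed (simp add: c qpoch_nth_0)

text \<open>Either the preceding limit applies, or the exponent \<open>e\<close> is so large that
  both sides vanish to order \<open>M\<close>. The bases are separate because in Gauss's identity
  the coefficient has the square of the base of the power.\<close>

lemma fps_agree_qbin_mult:
  assumes c: "c > 0" and k: "M \<le> k \<and> M + k \<le> n \<or> M \<le> e" and d: "d > 0"
  shows "fps_agree M ((fps_X ^ d) ^ e * qbin (fps_X ^ c) n k * qpoch (fps_X ^ c) M)
     ((fps_X ^ d) ^ e :: 'a :: field fps)"
proof (cases "M \<le> e")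
  case True
  have "fps_agree M ((fps_X ^ d) ^ e * (qbin (fps_X ^ c) n k * qpoch (fps_X ^ c) M)) (0 :: 'a fps)"
    using d True by (rule fps_agree_X_power_mult_0)
  also have "fps_agree M 0 ((fps_X ^ d) ^ e * 1 :: 'a fps)"
    using d True by (intro fps_agree_sym[OF fps_agree_X_power_mult_0])
  finally show ?thesis by (simp add: mult.assoc)
next
  case False
  hence "fps_agree M ((fps_X ^ d) ^ e * (qbin (fps_X ^ c) n k * qpoch (fps_X ^ c) M)) ((fps_X ^ d) ^ e * 1 :: 'a fps)"
    using k c by (intro fps_agree_mult fps_agree_refl fps_agree_qbin) auto
  thus ?thesis by (simp add: mult.assoc)
qed

text \<open>Separating odd from even exponents expresses the product in \<open>finite_gauss\<close>
  through E.\<close>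

lemma qpoch_double:
  "qpoch q (2 * n) = (\<Prod>i<n. 1 - q ^ (2 * i + 1)) * qpoch (q\<^sup>2) n"
proof (induction n)
  case (Suc n)
  have "qpoch q (2 * Suc n) = qpoch q (2 * n) * ((1 - q ^ (2 * n + 1)) * (1 - q ^ (2 * Suc n)))"
    by (simp add: qpoch_Suc mult.assoc)
  also have "q ^ (2 * Suc n) = (q\<^sup>2) ^ Suc n"
    by (simp only: power_mult)
  finally show ?case
    unfolding Suc by (simp only: qpoch_Suc prod.lessThan_Suc mult_ac)
qed simp

text \<open>The finite identity is taken at n = 2M: indices within distance \<open>M\<close> of the
  centre lie far enough from both ends of the row, and all others have exponent at least
  \<open>M\<close>. Of the two factors \<open>E\<close>, one cancels the Gaussian coefficient and
  the other remains.\<close>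

lemma fps_agree_gauss:
  assumes c: "c > 0"
  defines "q \<equiv> (fps_X :: 'a :: field fps) ^ c"
  shows "fps_agree M (qpoch q M ^ 2)
    ((\<Sum>k\<le>4*M. (-1) ^ k * q ^ nat ((int k - 2 * int M)\<^sup>2)) * qpoch (q\<^sup>2) M)"
proof -
  define n where "n = 2 * M"
  define E where "E = qpoch (q\<^sup>2) M"
  have q2: "q\<^sup>2 = fps_X ^ (2 * c)" by (simp add: q_def mult.commute flip: power_mult)
  have "fps_agree M (qpoch q M ^ 2) (qpoch q (2 * n) ^ 2)"
    unfolding q_def n_def
    by (intro fps_agree_power fps_agree_sym[OF fps_agree_qpoch[OF c]]) auto
  also have "qpoch q (2 * n) ^ 2 = (\<Prod>i<n. 1 - q ^ (2 * i + 1)) ^ 2 * qpoch (q\<^sup>2) n ^ 2"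
    by (simp add: qpoch_double power_mult_distrib)
  also have "fps_agree M \<dots> ((\<Prod>i<n. 1 - q ^ (2 * i + 1)) ^ 2 * E ^ 2)"
    unfolding E_def q2 using c
    by (intro fps_agree_power fps_agree_mult fps_agree_refl fps_agree_qpoch) (auto simp: n_def)
  also have "(\<Prod>i<n. 1 - q ^ (2 * i + 1)) ^ 2 * E ^ 2
     = (\<Sum>k\<le>4*M. (-1) ^ k * (q ^ nat ((int k - 2 * int M)\<^sup>2) * qbin (q\<^sup>2) (2 * n) k * E)) * E"
    by (subst finite_gauss) (auto simp: q_def n_def power_add power2_eq_square[of E] sum_distrib_right
        mult.assoc intro!: sum.cong)
  also have "fps_agree M \<dots> ((\<Sum>k\<le>4*M. (-1) ^ k * q ^ nat ((int k - 2 * int M)\<^sup>2)) * E)"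
  proof (intro fps_agree_mult fps_agree_sum fps_agree_refl)
    fix k
    have "M \<le> k \<and> M + k \<le> 2 * n \<or> M \<le> nat ((int k - 2 * int M)\<^sup>2)"
    proof (cases "M \<le> k \<and> M + k \<le> 2 * n")
      case False
      hence "int M \<le> \<bar>int k - 2 * int M\<bar>" by (auto simp: n_def)
      also have "\<dots> * 1 \<le> \<bar>int k - 2 * int M\<bar> * \<bar>int k - 2 * int M\<bar>"
        using False by (intro mult_left_mono) (auto simp: n_def)
      finally have "nat (int M) \<le> nat ((int k - 2 * int M)\<^sup>2)"
        by (intro nat_mono) (simp add: power2_eq_square)
      thus ?thesis by simp
    qed auto
    thus "fps_agree M (q ^ nat ((int k - 2 * int M)\<^sup>2) * qbin (q\<^sup>2) (2 * n) k * E)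
        (q ^ nat ((int k - 2 * int M)\<^sup>2))"
      unfolding E_def q2 unfolding q_def using c by (intro fps_agree_qbin_mult) auto
  qed
  finally show ?thesis unfolding E_def .
qed

text \<open>Again n = 2M, now with a single further factor \<open>E\<close> to cancel the Gaussian
  coefficients. The factor 2 stays because \<open>k\<close> and \<open>4*M+1 - k\<close> give equal
  terms.\<close>

lemma fps_agree_jacobi:
  assumes c: "c > 0"
  defines "q \<equiv> (fps_X :: 'a :: field fps) ^ c"
  shows "fps_agree M (2 * qpoch q M ^ 3)
    (\<Sum>k\<le>4*M+1. (-1) ^ k * of_int (4 * int M + 1 - 2 * int k) *
       q ^ nat ((int k - 2 * int M) * (int k - 2 * int M - 1) div 2))"
proof -
  define n where "n = 2 * M"
  define E where "E = qpoch q M"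
  have q0: "q \<noteq> 0" by (simp add: q_def)
  define T where "T = (\<lambda>k. nat ((int k - 2 * int M) * (int k - 2 * int M - 1) div 2))"
  have "fps_agree M (2 * E ^ 2 * E) (2 * qpoch q n ^ 2 * E)"
    unfolding E_def q_def n_def
    by (intro fps_agree_power fps_agree_mult fps_agree_refl fps_agree_sym[OF fps_agree_qpoch[OF c]]) auto
  also have "2 * qpoch q n ^ 2 * E
     = (\<Sum>k\<le>4*M+1. (-1) ^ k * of_int (4 * int M + 1 - 2 * int k) * (q ^ T k * qbin q (2 * n + 1) k * E))"
    unfolding finite_jacobi[OF q0] sum_distrib_right
    by (intro sum.cong) (simp_all add: n_def T_def power_add mult_ac)
  also have "fps_agree M \<dots> (\<Sum>k\<le>4*M+1. (-1) ^ k * of_int (4 * int M + 1 - 2 * int k) * q ^ T k)"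
  proof (intro fps_agree_mult fps_agree_sum fps_agree_refl)
    fix k
    have "M \<le> k \<and> M + k \<le> 2 * n + 1 \<or> M \<le> T k"
    proof (cases "M \<le> k \<and> M + k \<le> 2 * n + 1")
      case False
      define j where "j = int k - 2 * int M"
      have "j \<le> - int M - 1 \<or> j \<ge> int M + 2" using False by (auto simp: n_def j_def)
      hence "2 * int M \<le> j * (j - 1)"
      proof
        assume "j \<le> - int M - 1"
        hence "(int M + 1) * 2 \<le> (- j) * (1 - j)" by (intro mult_mono) auto
        thus ?thesis by (simp add: algebra_simps)
      next
        assume "j \<ge> int M + 2"
        hence "2 * (int M + 1) \<le> j * (j - 1)" by (intro mult_mono) auto
        thus ?thesis by simp
      qed
      hence "nat (int M) \<le> nat (j * (j - 1) div 2)" by (intro nat_mono) simp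
      thus ?thesis by (simp add: T_def j_def)
    qed auto
    thus "fps_agree M (q ^ T k * qbin q (2 * n + 1) k * E) (q ^ T k)"
      unfolding E_def q_def using c by (intro fps_agree_qbin_mult) auto
  qed
  finally show ?thesis unfolding E_def T_def by (simp add: power3_eq_cube power2_eq_square mult_ac)
qed

subsection \<open>Local integrality\<close>

text \<open>For prime \<open>l\<close> this is the localization of the integers at \<open>l\<close>.
  The fractions need not be reduced, which eases the closure proofs.\<close>

definition local_ints :: "nat \<Rightarrow> rat set" where
  "local_ints l = {of_int u / of_int v | u v. \<not> int l dvd v}"

definition fps_local :: "nat \<Rightarrow> rat fps \<Rightarrow> bool" where
  "fps_local l f \<longleftrightarrow> (\<forall>n. fps_nth f n \<in> local_ints l)"

context
  fixes l :: nat
  assumes l: "prime l"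
begin

lemma local_ints_frac: "\<not> int l dvd v \<Longrightarrow> of_int u / of_int v \<in> local_ints l"
  unfolding local_ints_def by blast

lemma local_ints_of_int: "of_int u \<in> local_ints l"
  using local_ints_frac[of 1 u] l by (auto dest: prime_gt_1_nat)

lemma local_ints_add:
  assumes "x \<in> local_ints l" "y \<in> local_ints l"
  shows "x + y \<in> local_ints l"
proof -
  from assms obtain u v u' v' where
    "x = of_int u / of_int v" "\<not> int l dvd v" "y = of_int u' / of_int v'" "\<not> int l dvd v'"
    unfolding local_ints_def by blast
  moreover from this have "v \<noteq> 0" "v' \<noteq> 0" by auto
  ultimately have "x + y = of_int (u * v' + u' * v) / of_int (v * v')" "\<not> int l dvd v * v'"
    using l by (auto simp: field_simps prime_dvd_mult_iff)
  thus ?thesis by (metis local_ints_frac)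
qed

lemma local_ints_mult:
  assumes "x \<in> local_ints l" "y \<in> local_ints l"
  shows "x * y \<in> local_ints l"
proof -
  from assms obtain u v u' v' where
    "x = of_int u / of_int v" "\<not> int l dvd v" "y = of_int u' / of_int v'" "\<not> int l dvd v'"
    unfolding local_ints_def by blast
  hence "x * y = of_int (u * u') / of_int (v * v')" "\<not> int l dvd v * v'"
    using l by (auto simp: prime_dvd_mult_iff)
  thus ?thesis by (metis local_ints_frac)
qed

lemma local_ints_sum: "(\<And>i. i \<in> A \<Longrightarrow> f i \<in> local_ints l) \<Longrightarrow> sum f A \<in> local_ints l"
  using local_ints_of_int[of 0]
  by (induction A rule: infinite_finite_induct) (auto intro: local_ints_add)

lemma local_ints_prod: "(\<And>i. i \<in> A \<Longrightarrow> f i \<in> local_ints l) \<Longrightarrow> prod f A \<in> local_ints l"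
  using local_ints_of_int[of 1]
  by (induction A rule: infinite_finite_induct) (auto intro: local_ints_mult)

text \<open>Returns from divisibility in the local ring to the reduced numerator: comparing
  fractions gives l u d = n v with \<open>v\<close> prime to \<open>l\<close>.\<close>

lemma dvd_numerator:
  assumes "x \<in> local_ints l"
  shows "int l dvd fst (quotient_of (of_nat l * x))"
proof -
  from assms obtain u v where uv: "x = of_int u / of_int v" "\<not> int l dvd v"
    unfolding local_ints_def by blast
  obtain n d where nd: "quotient_of (of_nat l * x) = (n, d)" by force
  have d: "d > 0" and x: "of_nat l * x = of_int n / of_int d"
    using nd by (auto simp: quotient_of_denom_pos quotient_of_div)
  have "v \<noteq> 0" using uv by auto
  with x d have "(of_int (int l * u * d) :: rat) = of_int (n * v)"
    by (simp add: uv(1) field_simps)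
  hence "int l * u * d = n * v" by (simp only: of_int_eq_iff)
  hence "int l dvd n * v" by (metis dvd_triv_left mult.assoc)
  with uv(2) l show ?thesis by (simp add: nd prime_dvd_mult_iff)
qed

text \<open>As j! divides k!, the quotient equals (k!/j!)/c, and \<open>c\<close> is prime to
  \<open>l\<close>.\<close>

lemma fact_div_fact_local_ints:
  assumes "j \<le> k" "fact k = l ^ e * c" "\<not> l dvd c"
  shows "of_nat (l ^ e) / fact j \<in> local_ints l"
proof -
  have "\<not> int l dvd int c" using assms(3) by simp
  hence c: "of_int (int (fact k div fact j)) / of_int (int c) \<in> local_ints l"
    by (rule local_ints_frac)
  have "fact k = (of_nat (fact k div fact j) :: rat) * fact j"
    using assms(1) by (metis dvd_div_mult_self fact_dvd of_nat_fact of_nat_mult)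
  moreover have "(fact k :: rat) = of_nat (l ^ e) * of_nat c"
    using assms(2) by (metis of_nat_fact of_nat_mult)
  moreover have "c \<noteq> 0" using assms(3) by (metis dvd_0_right)
  ultimately have "of_nat (l ^ e) / fact j = (of_nat (fact k div fact j) / of_nat c :: rat)"
    by (simp add: field_simps)
  thus ?thesis using c by simp
qed

text \<open>\<open>x\<close> is congruent to a natural number modulo the exact power of \<open>l\<close> dividing \<open>k!\<close>, and
  Vandermonde's identity reduces the claim to the two summands.\<close>

lemma gbinomial_local_ints:
  assumes "x \<in> local_ints l"
  shows "x gchoose k \<in> local_ints l"
proof -
  obtain c where c: "fact k = l ^ multiplicity l (fact k :: nat) * c" "\<not> l dvd c"
    using multiplicity_decompose'[of "fact k" l] l by (metis fact_nonzero not_prime_unit)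
  define e where "e = multiplicity l (fact k :: nat)"
  from assms obtain u v where uv: "x = of_int u / of_int v" "\<not> int l dvd v"
    unfolding local_ints_def by blast
  have "coprime (int l) v" using uv(2) l by (simp add: prime_imp_coprime)
  hence "coprime v (int l ^ e)" by (simp add: coprime_commute)
  \<comment> \<open>With \<open>v'\<close> inverse to \<open>v\<close>, the residue of u v' is the
    natural number \<open>w\<close> that represents \<open>x\<close> modulo l^e.\<close>
  then obtain v' where "[v * v' = 1] (mod int l ^ e)" using cong_solve_coprime_int by blast
  define w where "w = nat ((u * v') mod int l ^ e)"
  have l0: "int l ^ e > 0" using l by (simp add: prime_gt_0_nat)
  have w: "int w = (u * v') mod int l ^ e" unfolding w_def using l0 by simp
  have "[v * int w = v * (u * v')] (mod int l ^ e)"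
    unfolding w by (intro cong_scalar_left) simp
  also have "v * (u * v') = u * (v * v')" by simp
  also have "[u * (v * v') = u * 1] (mod int l ^ e)"
    using \<open>[v * v' = 1] (mod int l ^ e)\<close> by (rule cong_scalar_left)
  finally have "[u = v * int w] (mod int l ^ e)" by (simp add: cong_sym)
  then obtain t where t: "u - v * int w = int l ^ e * t" by (auto simp: cong_iff_dvd_diff)
  define y where "y = of_int t / (of_int v :: rat)"
  have y: "y \<in> local_ints l" unfolding y_def using uv(2) by (rule local_ints_frac)
  have "v \<noteq> 0" using uv(2) by auto
  have "(of_int u :: rat) = of_int v * of_nat w + of_nat (l ^ e) * of_int t"
    using arg_cong[OF t, of "of_int :: int \<Rightarrow> rat"] by (simp add: algebra_simps)
  hence x: "x = of_nat w + of_nat (l ^ e) * y"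
    using \<open>v \<noteq> 0\<close> by (simp add: uv(1) y_def field_simps)
  \<comment> \<open>For j > 0 the numerator of the binomial coefficient contains the factor l^e y,
    whose power of \<open>l\<close> absorbs the denominator j!.\<close>
  have "(of_nat (l ^ e) * y) gchoose j \<in> local_ints l" if "j \<le> k" for j
  proof (cases j)
    case (Suc i)
    define z where "z = of_nat (l ^ e) * y"
    have "z gchoose j = (of_nat (l ^ e) / fact j) * (y * (\<Prod>i=1..i. z - of_nat i))"
      by (simp add: Suc gbinomial_prod_rev prod.atLeast0_lessThan_Suc_shift prod.atLeast1_atMost_eq
            z_def lessThan_atLeast0 del: fact_Suc prod.op_ivl_Suc)
    moreover have "z - of_nat i \<in> local_ints l" for i
      using local_ints_add[OF local_ints_mult[OF local_ints_of_int[of "int l ^ e"] y] local_ints_of_int[of "- int i"]]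
      by (simp add: z_def)
    moreover have "of_nat (l ^ e) / fact j \<in> local_ints l"
      using that c unfolding e_def by (intro fact_div_fact_local_ints)
    ultimately show ?thesis
      unfolding z_def[symmetric] using y by (simp only:) (intro local_ints_mult local_ints_prod)
  qed (use local_ints_of_int[of 1] in simp)
  moreover have "of_nat w gchoose j \<in> local_ints l" for j
    using local_ints_of_int[of "int (w choose j)"] by (simp add: binomial_gbinomial)
  ultimately show ?thesis
    unfolding x gbinomial_Vandermonde[symmetric] by (auto intro!: local_ints_sum local_ints_mult)
qed

lemma fps_local_mult: "fps_local l f \<Longrightarrow> fps_local l g \<Longrightarrow> fps_local l (f * g)"
  by (auto simp: fps_local_def fps_mult_nth intro!: local_ints_sum local_ints_mult)

lemma fps_local_1: "fps_local l 1"
  using local_ints_of_int[of 0] local_ints_of_int[of 1] by (auto simp: fps_local_def)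

lemma fps_local_X: "fps_local l fps_X"
  using local_ints_of_int[of 0] local_ints_of_int[of 1] by (auto simp: fps_local_def fps_X_def)

lemma fps_local_diff: "fps_local l f \<Longrightarrow> fps_local l g \<Longrightarrow> fps_local l (f - g)"
  using local_ints_add local_ints_mult[OF local_ints_of_int[of "-1"]]
  by (fastforce simp: fps_local_def)

lemma fps_local_power: "fps_local l f \<Longrightarrow> fps_local l (f ^ k)"
  by (induction k) (auto intro: fps_local_mult fps_local_1)

lemma fps_local_prod: "(\<And>i. i \<in> A \<Longrightarrow> fps_local l (f i)) \<Longrightarrow> fps_local l (prod f A)"
  by (induction A rule: infinite_finite_induct) (auto intro: fps_local_mult fps_local_1)

lemma fps_local_binomial_power:
  assumes "fps_local l f" "s \<in> local_ints l"
  shows "fps_local l (fps_binomial_power f s)"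
proof -
  have "fps_local l ((f - 1) ^ k)" for k
    using assms(1) by (intro fps_local_power fps_local_diff fps_local_1)
  thus ?thesis
    using gbinomial_local_ints[OF assms(2)]
    unfolding fps_local_def fps_binomial_power_def fps_compose_nth
    by (auto intro!: local_ints_sum local_ints_mult)
qed

text \<open>A form of \<open>f\<^sup>l \<equiv> f(q\<^sup>l)\<close> modulo \<open>l\<close>: the derivative of \<open>f\<^sup>l\<close> is divisible by \<open>l\<close>.\<close>

lemma fps_local_power_nth:
  assumes f: "fps_local l f" and k: "\<not> l dvd k"
  shows "\<exists>x\<in>local_ints l. fps_nth (f ^ l) k = of_nat l * x"
proof -
  obtain j where j: "k = Suc j" using k by (cases k) auto
  have "fps_local l (fps_deriv f)"
    using f local_ints_mult[OF local_ints_of_int[of "int (Suc n)" for n]]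
    by (auto simp: fps_local_def)
  hence g: "fps_local l (fps_deriv f * f ^ (l - 1))"
    using f by (intro fps_local_mult fps_local_power)
  define y where "y = fps_nth (fps_deriv f * f ^ (l - 1)) j"
  have "of_nat k * fps_nth (f ^ l) k = fps_nth (fps_deriv (f ^ l)) j"
    by (simp add: j)
  also have "\<dots> = of_nat l * y"
    by (simp add: fps_deriv_power' y_def fps_of_nat[symmetric] mult.assoc del: fps_of_nat)
  \<comment> \<open>Dividing by \<open>k\<close> preserves integrality at \<open>l\<close>, since
    \<open>l\<close> does not divide \<open>k\<close>.\<close>
  finally have "fps_nth (f ^ l) k = of_nat l * (y * (of_int 1 / of_int (int k)))"
    using k by (cases "k = 0") (auto simp: field_simps)
  moreover have "y * (of_int 1 / of_int (int k)) \<in> local_ints l"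
    using g k by (intro local_ints_mult local_ints_frac) (auto simp: fps_local_def y_def)
  ultimately show ?thesis by blast
qed

end

subsection \<open>The congruences\<close>

lemma p1_eq_nth_partial_prod:
  assumes "m > 0"
  obtains M where "M \<ge> N" "p1 m t N = fps_nth (\<Prod>j\<le>M. p1_factor m t (Suc j)) N"
proof -
  \<comment> \<open>This excludes the case of \<open>has_prod\<close> in which some factor is zero,
    leaving convergence of the partial products from index 0.\<close>
  have "p1_factor m t j \<noteq> 0" for j
    using p1_factor_nth_0[of m t j] by (metis fps_zero_nth zero_neq_one)
  hence "(\<lambda>n. \<Prod>j\<le>n. p1_factor m t (Suc j)) \<longlonglongrightarrow> Abs_fps (p1 m t)"
    using has_prod_p1[OF assms, of t] by (auto simp: has_prod_def raw_has_prod_def)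
  hence "eventually (\<lambda>n. fps_nth (\<Prod>j\<le>n. p1_factor m t (Suc j)) N = p1 m t N) sequentially"
    by (simp add: tendsto_fps_iff)
  then obtain K where "\<And>n. n \<ge> K \<Longrightarrow> fps_nth (\<Prod>j\<le>n. p1_factor m t (Suc j)) N = p1 m t N"
    by (auto simp: eventually_sequentially)
  from this[of "max K N"] that[of "max K N"] show ?thesis by simp
qed

text \<open>The exponent laws hold for powers of \<open>1 + fps_X\<close>; substituting
  \<open>f - 1\<close>, which has constant term 0, is multiplicative and carries them over to
  \<open>f\<close>.\<close>

lemma fps_binomial_power_split:
  assumes "fps_nth f 0 = 1"
  shows "fps_binomial_power f (of_nat d + of_nat l * s) = f ^ d * fps_binomial_power f s ^ l"
proof -
  have 0: "fps_nth (f - 1) 0 = 0" using assms by simp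
  have "fps_binomial (of_nat d + of_nat l * s) = (1 + fps_X) ^ d * fps_binomial s ^ l"
    by (simp only: fps_binomial_add_mult fps_binomial_of_nat Formal_Power_Series.fps_binomial_power)
  hence "fps_binomial_power f (of_nat d + of_nat l * s) = ((1 + fps_X) oo (f - 1)) ^ d * fps_binomial_power f s ^ l"
    by (simp only: fps_binomial_power_def fps_compose_mult_distrib[OF 0] fps_compose_power[OF 0])
  also have "(1 + fps_X) oo (f - 1) = f"
    using 0 by (simp add: fps_compose_add_distrib fps_X_fps_compose_startby0)
  finally show ?thesis .
qed

lemma prod_p1_factor_split:
  "(\<Prod>j\<le>M. p1_factor 2 (of_nat d + of_nat l * s) (Suc j)) =
    (qpoch fps_X (Suc M) * qpoch (fps_X\<^sup>2) (Suc M)) ^ d * (\<Prod>j\<le>M. p1_factor 2 s (Suc j)) ^ l"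
proof -
  have "p1_factor 2 (of_nat d + of_nat l * s) (Suc j) =
      ((1 - fps_X ^ Suc j) * (1 - (fps_X\<^sup>2) ^ Suc j)) ^ d * p1_factor 2 s (Suc j) ^ l" for j
    unfolding p1_factor_def power_mult by (rule fps_binomial_power_split) (simp flip: power_mult)
  hence "(\<Prod>j\<le>M. p1_factor 2 (of_nat d + of_nat l * s) (Suc j)) =
      ((\<Prod>j\<le>M. 1 - fps_X ^ Suc j) * (\<Prod>j\<le>M. 1 - (fps_X\<^sup>2) ^ Suc j)) ^ d
        * (\<Prod>j\<le>M. p1_factor 2 s (Suc j)) ^ l"
    by (simp only: prod.distrib prod_power_distrib power_mult_distrib)
  thus ?thesis by (simp only: qpoch_def lessThan_Suc_atMost)
qed

text \<open>The coefficient collects the products \<open>a i * b j\<close> over pairs of exponents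
  with sum \<open>N\<close>, each divisible by \<open>m\<close>.\<close>

lemma dvd_nth_mult_sparse:
  fixes a b :: "nat \<Rightarrow> int" and e f :: "nat \<Rightarrow> nat"
  assumes "\<And>i j. e i + f j = N \<Longrightarrow> m dvd a i * b j"
  shows "\<exists>z. fps_nth ((\<Sum>i\<in>A. of_int (a i) * fps_X ^ e i) * (\<Sum>j\<in>B. of_int (b j) * fps_X ^ f j)) N
    = (of_int (m * z) :: 'a :: comm_ring_1)"
proof -
  have "(\<Sum>i\<in>A. of_int (a i) * fps_X ^ e i) * (\<Sum>j\<in>B. of_int (b j) * fps_X ^ f j)
      = (\<Sum>i\<in>A. \<Sum>j\<in>B. fps_const (of_int (a i * b j)) * fps_X ^ (e i + f j) :: 'a fps)"
    by (simp add: sum_product power_add fps_of_int[symmetric] fps_const_mult[symmetric] mult_ac del: fps_const_mult)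
  hence "fps_nth ((\<Sum>i\<in>A. of_int (a i) * fps_X ^ e i) * (\<Sum>j\<in>B. of_int (b j) * fps_X ^ f j)) N
    = (\<Sum>i\<in>A. \<Sum>j\<in>B. of_int (if e i + f j = N then a i * b j else 0) :: 'a)"
    by (auto simp: fps_sum_nth intro!: sum.cong)
  also have "\<dots> = of_int (\<Sum>i\<in>A. \<Sum>j\<in>B. if e i + f j = N then a i * b j else 0)"
    by simp
  finally have 1: "fps_nth ((\<Sum>i\<in>A. of_int (a i) * fps_X ^ e i) * (\<Sum>j\<in>B. of_int (b j) * fps_X ^ f j)) N
    = (of_int (\<Sum>i\<in>A. \<Sum>j\<in>B. if e i + f j = N then a i * b j else 0) :: 'a)" .
  have "m dvd (\<Sum>i\<in>A. \<Sum>j\<in>B. if e i + f j = N then a i * b j else 0)"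
    using assms by (intro dvd_sum) auto
  then obtain z where "(\<Sum>i\<in>A. \<Sum>j\<in>B. if e i + f j = N then a i * b j else 0) = m * z" ..
  thus ?thesis unfolding 1 by (intro exI[of _ z] arg_cong[of _ _ of_int])
qed

text \<open>Completing the square in Jacobi's exponent produces the square of the weight of the same
  term, so divisibility of the square root is divisibility of the coefficient.\<close>

lemma eight_mult_triangle:
  "8 * int (nat ((k - m) * (k - m - 1) div 2)) + 1 = (2 * m + 1 - 2 * k)\<^sup>2"
proof -
  define j where "j = k - m"
  have "j * (j - 1) \<ge> 0" by (cases "j \<le> 0") (auto intro: mult_nonpos_nonpos)
  moreover have "even (j * (j - 1))" by simp
  ultimately have "2 * int (nat (j * (j - 1) div 2)) = j * (j - 1)" by auto
  hence "8 * int (nat (j * (j - 1) div 2)) + 1 = 4 * (j * (j - 1)) + 1" by linarith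
  also have "\<dots> = (2 * m + 1 - 2 * k)\<^sup>2" by (simp add: j_def power2_eq_square algebra_simps)
  finally show ?thesis unfolding j_def .
qed

text \<open>Gauss's identity replaces \<open>E1\<^sup>2\<close> by a theta sum times
  \<open>E2\<close>; this \<open>E2\<close> completes \<open>E2\<^sup>2\<close> to a cube, to which
  Jacobi's identity applies, bringing in the factor 2.\<close>

lemma nth_euler_square:
  assumes l: "prime l" "odd l" "[l = 3] (mod 4)" and N: "l dvd 4 * N + 1" "N < M"
  shows "\<exists>z. 2 * fps_nth ((qpoch fps_X M * qpoch (fps_X\<^sup>2) M) ^ 2) N = (of_int (int l * z) :: 'a :: field)"
proof -
  define E1 E2 where "E1 = (qpoch fps_X M :: 'a fps)" and "E2 = (qpoch (fps_X\<^sup>2) M :: 'a fps)"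
  define m where "m = 2 * int M"
  define e where "e = (\<lambda>k. nat ((int k - m)\<^sup>2))"
  define T where "T = (\<lambda>k. nat ((int k - m) * (int k - m - 1) div 2))"
  define f where "f = (\<Sum>k\<le>4*M. of_int ((-1) ^ k) * fps_X ^ e k :: 'a fps)"
  define g where "g = (\<Sum>k\<le>4*M+1. of_int ((-1) ^ k * (2 * m + 1 - 2 * int k)) * fps_X ^ (2 * T k) :: 'a fps)"
  have "fps_agree M (E1\<^sup>2 * (2 * E2\<^sup>2)) ((f * E2) * (2 * E2\<^sup>2))"
    using fps_agree_gauss[of 1 M, where 'a = 'a]
    by (intro fps_agree_mult) (simp_all add: E1_def E2_def f_def e_def m_def)
  also have "(f * E2) * (2 * E2\<^sup>2) = f * (2 * E2 ^ 3)"
    by (simp add: power2_eq_square power3_eq_cube)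
  also have "fps_agree M \<dots> (f * g)"
    using fps_agree_jacobi[of 2 M, where 'a = 'a]
    by (intro fps_agree_mult) (simp_all add: E2_def g_def T_def m_def power_mult)
  finally have eq: "2 * fps_nth ((E1 * E2)\<^sup>2) N = fps_nth (f * g) N"
    using N(2) by (simp add: fps_agree_def power_mult_distrib fps_numeral_fps_const mult_ac)
  have dvd: "int l dvd (-1) ^ i * ((-1) ^ j * (2 * m + 1 - 2 * int j))"
    if "e i + 2 * T j = N" for i j
  proof -
    have e: "int (e i) = (int i - m)\<^sup>2" by (simp add: e_def)
    have "4 * int N + 1 = 4 * int (e i) + (8 * int (T j) + 1)" by (simp flip: that)
    also have "\<dots> = (2 * (int i - m))\<^sup>2 - (-1) * (2 * m + 1 - 2 * int j)\<^sup>2"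
      unfolding T_def eight_mult_triangle e by (simp add: power2_eq_square algebra_simps)
    finally have "int l dvd (2 * (int i - m))\<^sup>2 - (-1) * (2 * m + 1 - 2 * int j)\<^sup>2"
      using N(1) by (metis int_dvd_int_iff of_nat_add of_nat_mult of_nat_numeral of_nat_1)
    from dvd_of_dvd_norm_form[OF l(1,2) minus_one_power_half[OF l(3)] this]
    show ?thesis by simp
  qed
  show ?thesis
    unfolding eq[unfolded E1_def E2_def] f_def g_def
    by (rule dvd_nth_mult_sparse) (rule dvd)
qed

text \<open>Jacobi's identity is used for both cubes, with bases \<open>fps_X\<close> and
  \<open>fps_X\<^sup>2\<close>; hence the factor 4.\<close>

lemma nth_euler_cube:
  assumes l: "prime l" "odd l" "[l = 5] (mod 8) \<or> [l = 7] (mod 8)" and N: "l dvd 8 * N + 3" "N < M"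
  shows "\<exists>z. 4 * fps_nth ((qpoch fps_X M * qpoch (fps_X\<^sup>2) M) ^ 3) N = (of_int (int l * z) :: 'a :: field)"
proof -
  define E1 E2 where "E1 = (qpoch fps_X M :: 'a fps)" and "E2 = (qpoch (fps_X\<^sup>2) M :: 'a fps)"
  define m where "m = 2 * int M"
  define T where "T = (\<lambda>k. nat ((int k - m) * (int k - m - 1) div 2))"
  define g where "g = (\<lambda>c. \<Sum>k\<le>4*M+1. of_int ((-1) ^ k * (2 * m + 1 - 2 * int k)) * fps_X ^ (c * T k) :: 'a fps)"
  have "fps_agree M ((2 * E1 ^ 3) * (2 * E2 ^ 3)) (g 1 * g 2)"
    using fps_agree_jacobi[of 1 M, where 'a = 'a] fps_agree_jacobi[of 2 M, where 'a = 'a]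
    by (intro fps_agree_mult) (simp_all add: E1_def E2_def g_def T_def m_def power_mult)
  moreover have "(2 * E1 ^ 3) * (2 * E2 ^ 3) = 4 * (E1 * E2) ^ 3"
    by (simp add: power_mult_distrib)
  ultimately have eq: "4 * fps_nth ((E1 * E2) ^ 3) N = fps_nth (g 1 * g 2) N"
    using N(2) by (simp add: fps_agree_def fps_numeral_fps_const)
  have dvd: "int l dvd ((-1) ^ i * (2 * m + 1 - 2 * int i)) * ((-1) ^ j * (2 * m + 1 - 2 * int j))"
    if "1 * T i + 2 * T j = N" for i j
  proof -
    have "8 * int N + 3 = (8 * int (T i) + 1) + 2 * (8 * int (T j) + 1)" by (simp flip: that)
    also have "\<dots> = (2 * m + 1 - 2 * int i)\<^sup>2 - (-2) * (2 * m + 1 - 2 * int j)\<^sup>2"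
      unfolding T_def eight_mult_triangle by simp
    finally have "int l dvd (2 * m + 1 - 2 * int i)\<^sup>2 - (-2) * (2 * m + 1 - 2 * int j)\<^sup>2"
      using N(1) by (metis int_dvd_int_iff of_nat_add of_nat_mult of_nat_numeral)
    from dvd_of_dvd_norm_form[OF l(1,2) minus_two_power_half[OF l(1,3)] this]
    show ?thesis by simp
  qed
  show ?thesis
    unfolding eq[unfolded E1_def E2_def] g_def
    by (rule dvd_nth_mult_sparse) (rule dvd)
qed

text \<open>Serves to remove the factors 2 and 4 left by Jacobi's identity, which are invertible at
  an odd prime.\<close>

lemma local_ints_divide:
  assumes "prime l" "of_int v * x = of_int (int l * z)" "\<not> int l dvd v"
  shows "\<exists>y\<in>local_ints l. x = of_nat l * y"
proof
  show "of_int z / of_int v \<in> local_ints l" using assms(1,3) by (rule local_ints_frac)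
  have "v \<noteq> 0" using assms(3) by auto
  thus "x = of_nat l * (of_int z / of_int v)" using assms(2) by (simp add: field_simps)
qed

theorem theorem1p12:
  fixes a b d :: int and l r n :: nat
  assumes "b \<ge> 1"
    and "gcd a b = 1"
    and "prime l"
    and "odd l"
    and "int l dvd a + d * b"
    and "r < l"
    and "(d = 2 \<and> [l = 3] (mod 4) \<and> [4 * r + 1 = 0] (mod l)) \<or>
         (d = 3 \<and> ([l = 5] (mod 8) \<or> [l = 7] (mod 8)) \<and> [8 * r + 3 = 0] (mod l))"
  shows "int l dvd fst (quotient_of (p1 2 (- of_int a / of_int b) (l * n + r)))"
proof -
  define N where "N = l * n + r"
  obtain c where c: "a + d * b = int l * c" using assms(5) by blast
  define s :: rat where "s = of_int (- c) / of_int b"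
  define D where "D = nat d"
  have D: "int D = d" using assms(7) by (auto simp: D_def)
  have "\<not> int l dvd b"
  proof
    assume "int l dvd b"
    moreover from this have "int l dvd a" using assms(5) by (metis dvd_add_left_iff dvd_mult)
    ultimately have "int l dvd gcd a b" by simp
    thus False using assms(2,3) by (simp add: not_prime_unit)
  qed
  hence s: "s \<in> local_ints l" unfolding s_def using assms(3) by (intro local_ints_frac)
  have "(of_int (a + d * b) :: rat) = of_int (int l * c)" by (simp only: c)
  hence "- of_int a / of_int b = (of_int d + of_nat l * s :: rat)"
    using assms(1) by (simp add: s_def field_simps)
  hence t: "- of_int a / of_int b = (of_nat D + of_nat l * s :: rat)"
    by (simp flip: D)
  obtain M where M: "M \<ge> N" and
      p: "p1 2 (- of_int a / of_int b) N = fps_nth (\<Prod>j\<le>M. p1_factor 2 (- of_int a / of_int b) (Suc j)) N"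
    using p1_eq_nth_partial_prod[of 2 N] by auto
  define F :: "rat fps" where "F = (qpoch fps_X (Suc M) * qpoch (fps_X\<^sup>2) (Suc M)) ^ D"
  define S where "S = (\<Prod>j\<le>M. p1_factor 2 s (Suc j))"
  note loc = fps_local_mult fps_local_1 fps_local_X fps_local_diff fps_local_power fps_local_prod
  have F: "fps_local l F"
    unfolding F_def qpoch_def using assms(3) by (intro loc)
  have S: "fps_local l S"
    unfolding S_def p1_factor_def using assms(3) s by (intro loc fps_local_binomial_power)
  \<comment> \<open>Every term of the convolution is divisible by \<open>l\<close>: through
    \<open>S ^ l\<close> if \<open>l\<close> does not divide N - i, and otherwise through
    \<open>F\<close>, since then \<open>i\<close> is congruent to \<open>r\<close>.\<close>
  have "\<exists>y\<in>local_ints l. fps_nth F i * fps_nth (S ^ l) (N - i) = of_nat l * y" if i: "i \<le> N" for i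
  proof (cases "l dvd N - i")
    case False
    with fps_local_power_nth[OF assms(3) S] obtain y where
      "y \<in> local_ints l" "fps_nth (S ^ l) (N - i) = of_nat l * y" by blast
    with F show ?thesis
      by (intro bexI[of _ "fps_nth F i * y"]) (auto simp: fps_local_def intro!: local_ints_mult assms(3))
  next
    case True
    hence "[N = i] (mod l)" using i by (simp add: cong_altdef_nat)
    moreover have "[N = r] (mod l)" by (simp add: N_def cong_def)
    ultimately have ir: "[i = r] (mod l)" by (metis cong_sym cong_trans)
    \<comment> \<open>The product over j up to \<open>M\<close> has M + 1 factors, so the truncated
      identities are exact at every index up to \<open>N\<close>.\<close>
    have iM: "i < Suc M" using i M by simp
    have "\<exists>v z. of_int v * fps_nth F i = of_int (int l * z) \<and> (v = 2 \<or> v = 4)"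
    proof -
      consider (square) "d = 2" "[l = 3] (mod 4)" "[4 * r + 1 = 0] (mod l)"
        | (cube) "d = 3" "[l = 5] (mod 8) \<or> [l = 7] (mod 8)" "[8 * r + 3 = 0] (mod l)"
        using assms(7) by blast
      thus ?thesis
      proof cases
        case square
        have "[4 * i + 1 = 4 * r + 1] (mod l)" using ir by (intro cong_add cong_mult) auto
        hence "l dvd 4 * i + 1" using square(3) by (metis cong_trans cong_0_iff)
        from nth_euler_square[OF assms(3,4) square(2) this iM, where 'a = rat] obtain z where
          "2 * fps_nth F i = of_int (int l * z)"
          by (auto simp: F_def D_def square(1))
        thus ?thesis by (intro exI[of _ 2] exI[of _ z]) simp
      next
        case cube
        have "[8 * i + 3 = 8 * r + 3] (mod l)" using ir by (intro cong_add cong_mult) auto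
        hence "l dvd 8 * i + 3" using cube(3) by (metis cong_trans cong_0_iff)
        from nth_euler_cube[OF assms(3,4) cube(2) this iM, where 'a = rat] obtain z where
          "4 * fps_nth F i = of_int (int l * z)"
          by (auto simp: F_def D_def cube(1))
        thus ?thesis by (intro exI[of _ 4] exI[of _ z]) simp
      qed
    qed
    then obtain v z where v: "of_int v * fps_nth F i = of_int (int l * z)" "v = 2 \<or> v = 4" by blast
    have "\<not> int l dvd v"
    proof
      assume "int l dvd v"
      hence "int l dvd 2 \<or> int l dvd 2 * 2" using v(2) by auto
      moreover have "prime (int l)" using assms(3) by simp
      ultimately have "int l dvd 2" by (blast dest: prime_dvd_multD)
      hence "int l \<le> 2" by (rule zdvd_imp_le) simp
      hence "l = 2" using prime_ge_2_nat[OF assms(3)] by simp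
      thus False using assms(4) by simp
    qed
    from local_ints_divide[OF assms(3) v(1) this] obtain y where
      "y \<in> local_ints l" "fps_nth F i = of_nat l * y" by blast
    moreover have "fps_local l (S ^ l)" using assms(3) S by (rule fps_local_power)
    ultimately show ?thesis
      by (intro bexI[of _ "y * fps_nth (S ^ l) (N - i)"])
         (auto simp: fps_local_def intro!: local_ints_mult assms(3))
  qed
  then obtain y where y: "\<And>i. i \<le> N \<Longrightarrow> y i \<in> local_ints l"
      "\<And>i. i \<le> N \<Longrightarrow> fps_nth F i * fps_nth (S ^ l) (N - i) = of_nat l * y i"
    by metis
  have "p1 2 (- of_int a / of_int b) N = fps_nth (F * S ^ l) N"
    using p unfolding t prod_p1_factor_split F_def S_def .
  also have "\<dots> = of_nat l * (\<Sum>i=0..N. y i)"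
    unfolding fps_mult_nth sum_distrib_left using y(2) by (intro sum.cong) auto
  finally have "p1 2 (- of_int a / of_int b) N = of_nat l * (\<Sum>i=0..N. y i)" .
  moreover have "(\<Sum>i=0..N. y i) \<in> local_ints l"
    using y(1) assms(3) by (intro local_ints_sum) auto
  ultimately show ?thesis
    using dvd_numerator[OF assms(3), of "\<Sum>i=0..N. y i"] unfolding N_def[symmetric] by (simp only:)
qed

end
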